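(* Let $$A(t,z)=\sum_{n,k\ge 1}\bigl|\{\pi\in \mathcal{S}_n(312,4321) : \operatorname{cyc}(\pi)=k\}\bigr|\,t^kz^n,$$ a formal power series in $z$ with coefficients in $\mathbb{Z}[t]$. Then $$A(t,z)=\frac{tz(1-z^2)}{1-(1+t)(z+z^2)+tz^3}.$$
   Context: $\mathcal{S}_n$ is the set of permutations of $[n]=\{1,\dots,n\}$; $\pi\in\mathcal{S}_n$ is written in one-line notation as $\pi=\pi_1\pi_2\cdots\pi_n$ with $\pi_i=\pi(i)$. A permutation $\pi\in\mathcal{S}_n$ contains a pattern $\sigma\in\mathcal{S}_r$ if there are indices $i_1<\dots<i_r$ such that $\pi_{i_1}\cdots\pi_{i_r}$ is in the same relative order as $\sigma$; otherwise $\pi$ avoids $\sigma$. $\mathcal{S}_n(312,4321)$ is the set of $\pi\in\mathcal{S}_n$ avoiding both patterns $312$ and $4321$. $\operatorname{cyc}(\pi)$ is the number of cycles in the disjoint cycle decomposition of $\pi$, fixed points counted as cycles. *)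

theory Defs
  imports
    "HOL-Combinatorics.Orbits"
    "HOL-Computational_Algebra.Formal_Power_Series"
    "HOL-Computational_Algebra.Polynomial"
begin

text \<open>
  A permutation of \<open>[n]\<close> is a function \<open>p :: nat \<Rightarrow> nat\<close> with \<open>p permutes {1..n}\<close>; its one-line
  notation is \<open>p 1, \<dots>, p n\<close>. A pattern is given by its one-line notation as a list,
  so its entry at position \<open>a + 1\<close> is \<open>s ! a\<close>; accordingly the positions
  \<open>i\<^sub>1 < \<dots> < i\<^sub>r\<close> of an occurrence are \<open>i 0 < \<dots> < i (r - 1)\<close>.
\<close>

definition contains_pattern :: "nat \<Rightarrow> (nat \<Rightarrow> nat) \<Rightarrow> nat list \<Rightarrow> bool" where
  "contains_pattern n p s \<longleftrightarrow>
     (\<exists>i. strict_mono_on {..<length s} i \<and> i ` {..<length s} \<subseteq> {1..n} \<and>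
          (\<forall>a<length s. \<forall>b<length s. p (i a) < p (i b) \<longleftrightarrow> s ! a < s ! b))"

definition avoiders :: "nat \<Rightarrow> nat list set \<Rightarrow> (nat \<Rightarrow> nat) set" where
  "avoiders n P = {p. p permutes {1..n} \<and> (\<forall>s\<in>P. \<not> contains_pattern n p s)}"

text \<open>A fixed point contributes the singleton orbit.\<close>

definition cyc :: "nat \<Rightarrow> (nat \<Rightarrow> nat) \<Rightarrow> nat" where
  "cyc n p = card (orbit p ` {1..n})"

definition cyc_count :: "nat \<Rightarrow> nat \<Rightarrow> nat" where
  "cyc_count n k = card {p \<in> avoiders n {[3,1,2], [4,3,2,1]}. cyc n p = k}"

text \<open>
  The variable \<open>z\<close> is the power series variable and \<open>t\<close> the polynomial variable. For fixed \<open>n\<close> the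
  sum over \<open>k \<ge> 1\<close> may stop at \<open>n\<close>, since a permutation of \<open>[n]\<close> has at most \<open>n\<close> cycles;
  \<open>coeff_cyc_gf\<close> below confirms that no term is lost.
\<close>

definition cyc_gf :: "int poly fps" where
  "cyc_gf = Abs_fps (\<lambda>n. if n \<ge> 1 then \<Sum>k=1..n. monom (int (cyc_count n k)) k else 0)"

lemma cyc_le: "cyc n p \<le> n"
  unfolding cyc_def using card_image_le[of "{1..n}" "orbit p"] by simp

lemma cyc_count_eq_0: "k > n \<Longrightarrow> cyc_count n k = 0"
  unfolding cyc_count_def using cyc_le[of n] by (auto simp: card_eq_0_iff dest: leD)

lemma coeff_cyc_gf:
  "coeff (fps_nth cyc_gf n) k = (if n \<ge> 1 \<and> k \<ge> 1 then int (cyc_count n k) else 0)"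
proof (cases "n \<ge> 1")
  case True
  then have "coeff (fps_nth cyc_gf n) k = (\<Sum>j=1..n. if j = k then int (cyc_count n j) else 0)"
    by (simp add: cyc_gf_def coeff_sum)
  also have "\<dots> = (if k \<in> {1..n} then int (cyc_count n k) else 0)"
    by (simp add: sum.delta')
  finally show ?thesis
    using True cyc_count_eq_0[of n k] by auto
qed (simp add: cyc_gf_def)

text \<open>
  The operator \<open>/\<close> on formal power series needs coefficients with an inverse operation, which
  \<open>int poly\<close> lacks. For \<open>D\<close> with constant coefficient 1, the quotient \<open>N / D\<close> is the product
  of \<open>N\<close> with the inverse series of \<open>D\<close>, and it is characterised as usual:
\<close>

lemma fps_quotient_iff:
  fixes A N D :: "'a :: comm_ring_1 fps"
  assumes "fps_nth D 0 = 1"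
  shows "A = N * fps_right_inverse D 1 \<longleftrightarrow> A * D = N"
proof -
  have inv: "D * fps_right_inverse D 1 = 1"
    using assms by (intro fps_right_inverse) simp
  show ?thesis
  proof
    assume "A = N * fps_right_inverse D 1"
    then have "A * D = N * (D * fps_right_inverse D 1)"
      by (simp only: mult.assoc mult.commute[of D])
    then show "A * D = N" using inv by simp
  next
    assume "A * D = N"
    then have "N * fps_right_inverse D 1 = A * (D * fps_right_inverse D 1)"
      by (simp only: mult.assoc [symmetric])
    then show "A = N * fps_right_inverse D 1" using inv by simp
  qed
qed

end

theory Submission
  imports Defs
begin

text \<open>
  If \<open>\<pi>\<close> avoids 312 and 4321, then the entries after its maximum \<open>n\<close> are decreasing and at most two.
  So \<open>n\<close> is in one of the last three positions, and the third to last one splits according to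
  whether \<open>n - 1\<close> comes right after or right before \<open>n\<close>. Write \<open>A\<^sub>n\<close> for the set of
  avoiders, with \<open>A\<^sub>n\<^sub>-\<^sub>1\<close> embedded in \<open>A\<^sub>n\<close> by adding a fixed point. The four cases are, in this order,
  \<open>A\<^sub>n\<^sub>-\<^sub>1\<close>, \<open>A\<^sub>n\<^sub>-\<^sub>1 \<circ> (n-1 n)\<close>, \<open>A\<^sub>n\<^sub>-\<^sub>2 \<circ> (n-2 n)\<close> and \<open>(A\<^sub>n\<^sub>-\<^sub>2 - A\<^sub>n\<^sub>-\<^sub>3) \<circ> (n-3 n-1) \<circ> (n-2 n)\<close>.
  Composing with a transposition of an old and a new point lengthens one cycle, so new cycles
  come only from the new fixed point (\<open>n\<close>, respectively \<open>n - 1\<close>) in the first and third case.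
  Hence the cycle polynomials satisfy
  \<open>a\<^sub>n = (1 + t) (a\<^sub>n\<^sub>-\<^sub>1 + a\<^sub>n\<^sub>-\<^sub>2) - t a\<^sub>n\<^sub>-\<^sub>3\<close> for \<open>n \<ge> 3\<close>.
\<close>

section \<open>Pattern avoidance as inequalities between entries\<close>

definition Av :: "nat \<Rightarrow> (nat \<Rightarrow> nat) set" where
  "Av n = avoiders n {[3,1,2], [4,3,2,1]}"

lemma contains_312_iff:
  "contains_pattern n p [3,1,2] \<longleftrightarrow>
    (\<exists>i j k. 1 \<le> i \<and> i < j \<and> j < k \<and> k \<le> n \<and> p j < p k \<and> p k < p i)" (is "?L \<longleftrightarrow> ?R")
proof
  assume ?L
  have l: "length [3,1,2::nat] = 3" by simp
  from \<open>?L\<close> obtain f where f: "strict_mono_on {..<3} f" "f ` {..<3} \<subseteq> {1..n}"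
    and o: "\<forall>a<3. \<forall>b<3. p (f a) < p (f b) \<longleftrightarrow> [3::nat,1,2] ! a < [3,1,2] ! b"
    unfolding contains_pattern_def l by blast
  have "f 0 < f 1" "f 1 < f 2" using f(1) by (auto simp: strict_mono_on_def)
  moreover have "1 \<le> f 0" "f 2 \<le> n" using f(2) by (auto simp: image_subset_iff)
  moreover have "p (f 1) < p (f 2)" "p (f 2) < p (f 0)" using o by auto
  ultimately show ?R by blast
next
  assume ?R
  then obtain i j k where "1 \<le> i" "i < j" "j < k" "k \<le> n" "p j < p k" "p k < p i" by blast
  then show ?L unfolding contains_pattern_def
    by (intro exI[of _ "\<lambda>a. [i,j,k] ! a"])
      (auto simp: strict_mono_on_def less_Suc_eq)
qed

lemma contains_4321_iff:
  "contains_pattern n p [4,3,2,1] \<longleftrightarrow>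
    (\<exists>i j k l. 1 \<le> i \<and> i < j \<and> j < k \<and> k < l \<and> l \<le> n \<and> p l < p k \<and> p k < p j \<and> p j < p i)"
    (is "?L \<longleftrightarrow> ?R")
proof
  assume ?L
  have l: "length [4,3,2,1::nat] = 4" by simp
  from \<open>?L\<close> obtain f where f: "strict_mono_on {..<4} f" "f ` {..<4} \<subseteq> {1..n}"
    and o: "\<forall>a<4. \<forall>b<4. p (f a) < p (f b) \<longleftrightarrow> [4::nat,3,2,1] ! a < [4,3,2,1] ! b"
    unfolding contains_pattern_def l by blast
  have "f 0 < f 1" "f 1 < f 2" "f 2 < f 3" using f(1) by (auto simp: strict_mono_on_def)
  moreover have "1 \<le> f 0" "f 3 \<le> n" using f(2) by (auto simp: image_subset_iff)
  moreover have "p (f 1) < p (f 0)" "p (f 2) < p (f 1)" "p (f 3) < p (f 2)"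
    using o by (auto simp: numeral_3_eq_3)
  ultimately show ?R by blast
next
  assume ?R
  then obtain i j k l where "1 \<le> i" "i < j" "j < k" "k < l" "l \<le> n" "p l < p k" "p k < p j" "p j < p i"
    by blast
  then show ?L unfolding contains_pattern_def
    by (intro exI[of _ "\<lambda>a. [i,j,k,l] ! a"])
      (auto simp: strict_mono_on_def less_Suc_eq)
qed

text \<open>One strict inequality of each pattern is moved to the conclusion and negated. Avoidance
  thus becomes an upper bound on the first entry \<open>p i\<close>, the form in which it is applied
  below.\<close>

lemma Av_iff:
  "p \<in> Av n \<longleftrightarrow> p permutes {1..n} \<and>
    (\<forall>i j k. 1 \<le> i \<longrightarrow> i < j \<longrightarrow> j < k \<longrightarrow> k \<le> n \<longrightarrow> p j < p k \<longrightarrow> p i \<le> p k) \<and>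
    (\<forall>i j k l. 1 \<le> i \<longrightarrow> i < j \<longrightarrow> j < k \<longrightarrow> k < l \<longrightarrow> l \<le> n \<longrightarrow>
       p l < p k \<longrightarrow> p k < p j \<longrightarrow> p i \<le> p j)"
proof -
  have "p \<in> Av n \<longleftrightarrow> p permutes {1..n} \<and>
      \<not> contains_pattern n p [3,1,2] \<and> \<not> contains_pattern n p [4,3,2,1]"
    by (simp add: Av_def avoiders_def del: One_nat_def)
  then show ?thesis
    unfolding contains_312_iff contains_4321_iff not_less [symmetric] by blast
qed

lemma Av_permutes: "p \<in> Av n \<Longrightarrow> p permutes {1..n}"
  by (simp add: Av_def avoiders_def)

lemma Av_no_312:
  "\<lbrakk>p \<in> Av n; 1 \<le> i; i < j; j < k; k \<le> n; p j < p k\<rbrakk> \<Longrightarrow> p i \<le> p k"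
  unfolding Av_iff by blast

lemma Av_no_4321:
  "\<lbrakk>p \<in> Av n; 1 \<le> i; i < j; j < k; k < l; l \<le> n; p l < p k; p k < p j\<rbrakk> \<Longrightarrow> p i \<le> p j"
  unfolding Av_iff by blast

lemma permutes_le: "p permutes {1..n::nat} \<Longrightarrow> i \<le> n \<Longrightarrow> p i \<le> n"
  using permutes_in_image[of p "{1..n}" i] permutes_not_in[of p "{1..n}" i]
  by (cases "i = 0") auto

lemma finite_Av: "finite (Av n)"
  by (rule finite_subset[OF _ finite_permutations[of "{1..n}"]]) (auto dest: Av_permutes)

section \<open>Insertion of a new maximum\<close>

text \<open>The one-line notation of \<open>q\<close> is that of \<open>p\<close> with the new maximum inserted at position \<open>k\<close>.
  What follows a maximum is decreasing of length at most 2.\<close>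

lemma Av_insert_max_iff:
  assumes p: "p permutes {1..n}" and q: "q permutes {1..Suc n}"
    and k: "1 \<le> k" "k \<le> Suc n" "q k = Suc n"
    and before: "\<And>i. i < k \<Longrightarrow> q i = p i"
    and after: "\<And>i. k \<le> i \<Longrightarrow> i \<le> n \<Longrightarrow> q (Suc i) = p i"
  shows "q \<in> Av (Suc n) \<longleftrightarrow> p \<in> Av n \<and> n \<le> Suc k \<and> (n = Suc k \<longrightarrow> q (Suc n) < q n)"
proof -
  have less: "q i < Suc n" if "i \<noteq> k" "i \<le> Suc n" for i
    using permutes_le[OF q that(2)] permutes_inj[OF q] k(3) that(1)
    by (metis inj_eq le_neq_implies_less)
  \<comment> \<open>\<open>d\<close> sends positions of \<open>p\<close> to positions of
    \<open>q\<close>, skipping \<open>k\<close>; \<open>e\<close> goes back and is meaningful away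
    from \<open>k\<close>. Both preserve order, so occurrences of patterns that do not involve the
    maximum transfer in both directions.\<close>
  define d where "d i = (if i < k then i else Suc i)" for i
  define e where "e i = (if i < k then i else i - 1)" for i
  have d: "p i = q (d i)" if "i \<le> n" for i
    using before after that by (auto simp: d_def)
  have d_mono: "i < j \<Longrightarrow> d i < d j" and d_le: "i \<le> n \<Longrightarrow> d i \<le> Suc n" and d_ge: "i \<le> d i" for i j
    using k by (auto simp: d_def)
  have e: "q i = p (e i)" if "i \<noteq> k" "i \<le> Suc n" for i
    using before[of i] after[of "i - 1"] that by (auto simp: e_def)
  have e_mono: "i < j \<Longrightarrow> i \<noteq> k \<Longrightarrow> j \<noteq> k \<Longrightarrow> e i < e j"
    and e_le: "i \<le> Suc n \<Longrightarrow> i \<noteq> k \<Longrightarrow> e i \<le> n" and e_ge: "1 \<le> i \<Longrightarrow> i \<noteq> k \<Longrightarrow> 1 \<le> e i" for i j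
    using k by (auto simp: e_def)
  show ?thesis
  proof
    assume Q: "q \<in> Av (Suc n)"
    have "p \<in> Av n"
      unfolding Av_iff
    proof (intro conjI allI impI p)
      fix i j l assume "1 \<le> i" "i < j" "j < l" "l \<le> n" "p j < p l"
      then show "p i \<le> p l"
        using Av_no_312[OF Q, of "d i" "d j" "d l"] d[of i] d[of j] d[of l] d_mono d_le[of l] d_ge[of i]
        by simp
    next
      fix i j l m assume "1 \<le> i" "i < j" "j < l" "l < m" "m \<le> n" "p m < p l" "p l < p j"
      then show "p i \<le> p j"
        using Av_no_4321[OF Q, of "d i" "d j" "d l" "d m"] d[of i] d[of j] d[of l] d[of m]
          d_mono d_le[of m] d_ge[of i]
        by simp
    qed
    \<comment> \<open>An ascent after position \<open>k\<close> would form 312 with the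
      maximum.\<close>
    moreover have decr: "q j < q i" if "k < i" "i < j" "j \<le> Suc n" for i j
    proof -
      have "\<not> q i < q j" using Av_no_312[OF Q k(1) that] less[of j] that k(3) by auto
      moreover have "q i \<noteq> q j" using permutes_inj[OF q] that by (auto dest: injD)
      ultimately show ?thesis by simp
    qed
    \<comment> \<open>Three positions after \<open>k\<close> would carry decreasing entries, which
      form 4321 with the maximum.\<close>
    moreover have "n \<le> Suc k"
    proof (rule ccontr)
      assume "\<not> ?thesis"
      then show False
        using Av_no_4321[OF Q k(1), of "k+1" "k+2" "k+3"] decr[of "k+1" "k+2"] decr[of "k+2" "k+3"]
          less[of "k+1"] k(3) by simp
    qed
    ultimately show "p \<in> Av n \<and> n \<le> Suc k \<and> (n = Suc k \<longrightarrow> q (Suc n) < q n)" by simp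
  next
    assume "p \<in> Av n \<and> n \<le> Suc k \<and> (n = Suc k \<longrightarrow> q (Suc n) < q n)"
    then have P: "p \<in> Av n" and nk: "n \<le> Suc k" and desc: "n = Suc k \<Longrightarrow> q (Suc n) < q n" by auto
    show "q \<in> Av (Suc n)"
      unfolding Av_iff
    proof (intro conjI allI impI q)
      fix i j l assume *: "1 \<le> i" "i < j" "j < l" "l \<le> Suc n" "q j < q l"
      then have jk: "j \<noteq> k" using permutes_le[OF q, of l] k(3) by auto
      show "q i \<le> q l"
      proof (cases "i = k")
        case True
        \<comment> \<open>The maximum plays the 3. At most two positions follow it, so the 1 and the
          2 occupy exactly the last two, where \<open>desc\<close> forbids an ascent.\<close>
        then have "n = Suc k" "j = n" "l = Suc n" using * nk by auto
        then have "q l < q j" using desc by metis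
        then show ?thesis using *(5) by simp
      next
        case ik: False
        show ?thesis
        proof (cases "l = k")
          case True
          then show ?thesis using k(3) permutes_le[OF q, of i] * by simp
        next
          case False
          then show ?thesis
            using Av_no_312[OF P, of "e i" "e j" "e l"] * ik jk e[of i] e[of j] e[of l]
              e_mono e_le[of l] e_ge[of i] by simp
        qed
      qed
    next
      fix i j l m assume *: "1 \<le> i" "i < j" "j < l" "l < m" "m \<le> Suc n" "q m < q l" "q l < q j"
      \<comment> \<open>The 4 of the pattern needs three positions after it, but at most two follow
        \<open>k\<close>.\<close>
      have ik: "i \<noteq> k" using * nk by auto
      have lk: "l \<noteq> k" "m \<noteq> k" using * k(3) permutes_le[OF q, of j] by auto
      show "q i \<le> q j"
      proof (cases "j = k")
        case True
        then show ?thesis using k(3) permutes_le[OF q, of i] * by simp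
      next
        case False
        then show ?thesis
          using Av_no_4321[OF P, of "e i" "e j" "e l" "e m"] * ik lk e[of i] e[of j] e[of l] e[of m]
            e_mono e_le[of m] e_ge[of i] by simp
      qed
    qed
  qed
qed

section \<open>Cycle counts under composition with a transposition\<close>

text \<open>\<open>p\<close> fixes \<open>y\<close>, so the composite maps \<open>x\<close> to
  \<open>y\<close> and \<open>y\<close> to \<open>p x\<close> and agrees with \<open>p\<close>
  elsewhere: \<open>y\<close> is inserted right after \<open>x\<close> in its cycle. The ground set
  is arbitrary because new points are not always added in numerical order.\<close>

lemma orbit_comp_transpose:
  assumes S: "finite S" and p: "p permutes S" and x: "x \<in> S" and y: "y \<notin> S" and s: "s \<in> S"
  shows "orbit (p \<circ> transpose x y) s = orbit p s \<union> (if x \<in> orbit p s then {y} else {})"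
    (is "_ = ?R")
proof -
  define q where "q = p \<circ> transpose x y"
  have pm: "permutation p" using S p by (auto simp: permutation_permutes)
  have qx: "q x = y" using permutes_not_in[OF p y] by (simp add: q_def)
  have qy: "q y = p x" by (simp add: q_def)
  have qo: "q z = p z" if "z \<noteq> x" "z \<noteq> y" for z using that by (simp add: q_def transpose_def)
  have sub: "orbit p s \<subseteq> S"
    using permutes_orbit_subset[OF p s] .
  \<comment> \<open>A path of \<open>p\<close> is followed by \<open>q\<close>, with a detour
    through \<open>y\<close> at each visit to \<open>x\<close>.\<close>
  have "z \<in> orbit q s" if "z \<in> orbit p s" for z
    using that
  proof (induction rule: orbit.induct)
    case base
    show ?case
    proof (cases "s = x")
      case True
      then have "y \<in> orbit q s" using orbit.base[of q s] qx by simp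
      from orbit.step[OF this] show ?thesis using True qy by simp
    next
      case False
      then have "q s = p s" using qo[of s] s y by auto
      then show ?thesis using orbit.base[of q s] by simp
    qed
  next
    case (step z)
    have zS: "z \<in> S" using step sub by auto
    show ?case
    proof (cases "z = x")
      case True
      then have "y \<in> orbit q s" using orbit.step[OF step.IH] qx by simp
      from orbit.step[OF this] show ?thesis using True qy by simp
    next
      case False
      then have "q z = p z" using qo[of z] zS y by auto
      then show ?thesis using orbit.step[OF step.IH] by simp
    qed
  qed
  moreover have "y \<in> orbit q s" if "x \<in> orbit p s"
    using orbit.step[of x q s] calculation[OF that] qx by simp
  moreover have "z \<in> ?R" if "z \<in> orbit q s" for z
    using that
  proof (induction rule: orbit.induct)
    case base
    show ?case
    proof (cases "s = x")
      case True
      \<comment> \<open>\<open>orbit\<close> begins with one application of the function, so that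
        \<open>x\<close> lies in its own orbit relies on \<open>p\<close> being a
        permutation.\<close>
      then show ?thesis using qx permutation_self_in_orbit[OF pm, of x] by simp
    next
      case False
      then have "q s = p s" using qo[of s] s y by auto
      then show ?thesis using orbit.base[of p s] by simp
    qed
  next
    case (step z)
    show ?case
    proof (cases "z = y")
      case True
      then have "x \<in> orbit p s" using step.IH y sub by (auto split: if_splits)
      then show ?thesis using orbit.step[of x p s] True qy by simp
    next
      case False
      then have z: "z \<in> orbit p s" using step.IH by (auto split: if_splits)
      show ?thesis
      proof (cases "z = x")
        case True
        then show ?thesis using z qx by simp
      next
        case False
        then show ?thesis using orbit.step[OF z] qo[of z] \<open>z \<noteq> y\<close> by auto
      qed
    qed
  qed
  ultimately have "orbit q s = ?R"
    by (cases "x \<in> orbit p s"; simp; blast)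
  then show ?thesis unfolding q_def .
qed

text \<open>The point \<open>y\<close> joins the orbit of \<open>x\<close>, so no orbit is created.
  None is lost either: no orbit of \<open>p\<close> on \<open>S\<close> contains \<open>y\<close>,
  so deleting \<open>y\<close> recovers the old orbits.\<close>

lemma card_orbits_comp_transpose:
  assumes S: "finite S" and p: "p permutes S" and x: "x \<in> S" and y: "y \<notin> S"
  shows "card (orbit (p \<circ> transpose x y) ` insert y S) = card (orbit p ` S)"
proof -
  let ?q = "p \<circ> transpose x y"
  define g where "g C = C \<union> (if x \<in> C then {y} else {})" for C
  have qp: "?q permutes insert y S"
    using p x by (intro permutes_compose[OF permutes_swap_id permutes_subset[OF p]]) auto
  then have pm: "permutation ?q" using S by (auto simp: permutation_permutes)
  have qx: "?q x = y" using permutes_not_in[OF p y] by simp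
  have "orbit ?q y = orbit ?q x"
    using permutation_orbit_step[OF pm, of x] qx by simp
  then have "orbit ?q ` insert y S = orbit ?q ` S" using x by auto
  also have "\<dots> = g ` orbit p ` S"
    using orbit_comp_transpose[OF S p x y] by (auto simp: g_def image_image)
  also have "card \<dots> = card (orbit p ` S)"
  proof (rule card_image, rule inj_onI)
    fix A B assume "A \<in> orbit p ` S" "B \<in> orbit p ` S" and g: "g A = g B"
    then have "y \<notin> A" "y \<notin> B" using permutes_orbit_subset[OF p] y by auto
    then show "A = B" using g by (auto simp: g_def split: if_splits)
  qed
  finally show ?thesis .
qed

lemma card_orbits_fixpoint:
  assumes S: "finite S" and p: "p permutes S" and y: "y \<notin> S"
  shows "card (orbit p ` insert y S) = Suc (card (orbit p ` S))"
proof -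
  have "orbit p y = {y}"
    using permutes_not_in[OF p y] by (simp add: orbit_eq_singleton_iff)
  moreover have "orbit p s \<noteq> {y}" if "s \<in> S" for s
    using permutes_orbit_subset[OF p that] y by auto
  ultimately show ?thesis using S by (auto simp: card_insert_if)
qed


lemma cyc_Suc_fixpoint:
  assumes "p permutes {1..n}"
  shows "cyc (Suc n) p = Suc (cyc n p)"
  using card_orbits_fixpoint[OF _ assms, of "Suc n"]
  by (simp add: cyc_def atLeastAtMostSuc_conv)

lemma cyc_comp_transpose_1:
  assumes "p permutes {1..Suc n}"
  shows "cyc (n + 2) (p \<circ> transpose (n + 1) (n + 2)) = cyc (n + 1) p"
  using card_orbits_comp_transpose[OF _ assms, of "n + 1" "n + 2"]
  by (simp add: cyc_def atLeastAtMostSuc_conv)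

lemma permutes_comp_transpose:
  assumes "p permutes S" "x \<in> S"
  shows "p \<circ> transpose x y permutes insert y S"
  using assms by (intro permutes_compose[OF permutes_swap_id permutes_subset[OF assms(1)]]) auto

text \<open>The point \<open>n + 3\<close> enters an old cycle, while \<open>n + 2\<close> stays
  fixed and is the one new cycle. Hence the ground set grows first by \<open>n + 3\<close> and then
  by \<open>n + 2\<close>.\<close>

lemma cyc_comp_transpose_2:
  assumes p: "p permutes {1..Suc n}"
  shows "cyc (n + 3) (p \<circ> transpose (n + 1) (n + 3)) = Suc (cyc (n + 1) p)"
proof -
  let ?q = "p \<circ> transpose (n + 1) (n + 3)"
  let ?S = "insert (n + 3) {1..Suc n}"
  have S: "{1..n + 3} = insert (n + 2) ?S" by auto
  have "?q permutes ?S" by (rule permutes_comp_transpose[OF p]) simp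
  then have "card (orbit ?q ` insert (n + 2) ?S) = Suc (card (orbit ?q ` ?S))"
    by (intro card_orbits_fixpoint) auto
  also have "card (orbit ?q ` ?S) = card (orbit p ` {1..Suc n})"
    by (rule card_orbits_comp_transpose[OF _ p]) auto
  finally show ?thesis unfolding cyc_def S Suc_eq_plus1 .
qed

lemma cyc_comp_transpose_3:
  assumes p: "p permutes {1..Suc n}" and n: "n \<ge> 1"
  shows "cyc (n + 3) (p \<circ> transpose n (n + 2) \<circ> transpose (n + 1) (n + 3)) = cyc (n + 1) p"
proof -
  let ?r = "p \<circ> transpose n (n + 2)"
  let ?S = "insert (n + 2) {1..Suc n}"
  have S: "{1..n + 3} = insert (n + 3) ?S" by auto
  have "?r permutes ?S" by (rule permutes_comp_transpose[OF p]) (use n in simp)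
  then have "card (orbit (?r \<circ> transpose (n + 1) (n + 3)) ` insert (n + 3) ?S) = card (orbit ?r ` ?S)"
    by (intro card_orbits_comp_transpose) auto
  also have "\<dots> = card (orbit p ` {1..Suc n})"
    by (rule card_orbits_comp_transpose[OF _ p]) (use n in auto)
  finally show ?thesis unfolding cyc_def S by simp
qed

section \<open>Avoidance in the four cases\<close>

text \<open>Insertion of the maximum in the last position does not change the function:
  \<open>p\<close> plays both roles in \<open>Av_insert_max_iff\<close>.\<close>

lemma Av_Suc_fixpoint_iff:
  assumes p: "p permutes {1..n}"
  shows "p \<in> Av (Suc n) \<longleftrightarrow> p \<in> Av n"
proof -
  have "p permutes {1..Suc n}" by (rule permutes_subset[OF p]) auto
  moreover have "p (Suc n) = Suc n" by (rule permutes_not_in[OF p]) simp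
  ultimately show ?thesis using Av_insert_max_iff[OF p, of p "Suc n"] by simp
qed

lemma Av_subset: "Av n \<subseteq> Av (Suc n)"
  using Av_Suc_fixpoint_iff Av_permutes by blast

text \<open>Permutations are functions that are the identity outside their ground set, so
  \<open>Av n\<close> consists of the members of \<open>Av (Suc n)\<close> that fix
  \<open>Suc n\<close>.\<close>

lemma Av_diff: "Av (Suc n) - Av n = {p \<in> Av (Suc n). p (Suc n) \<noteq> Suc n}"
proof -
  have "p permutes {1..n}" if "p \<in> Av (Suc n)" "p (Suc n) = Suc n" for p
    by (rule permutes_superset[OF Av_permutes[OF that(1)]]) (use that(2) in \<open>auto simp: le_Suc_eq\<close>)
  then have "p \<in> Av n" if "p \<in> Av (Suc n)" "p (Suc n) = Suc n" for p
    using Av_Suc_fixpoint_iff that by blast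
  moreover have "p (Suc n) = Suc n" if "p \<in> Av n" for p
    by (rule permutes_not_in[OF Av_permutes[OF that]]) simp
  ultimately show ?thesis by blast
qed

lemma Av_comp_transpose_1_iff:
  assumes p: "p permutes {1..Suc n}"
  shows "p \<circ> transpose (n + 1) (n + 2) \<in> Av (n + 2) \<longleftrightarrow> p \<in> Av (n + 1)"
proof -
  let ?q = "p \<circ> transpose (n + 1) (n + 2)"
  have fp: "p (n + 2) = n + 2" by (rule permutes_not_in[OF p]) simp
  have "?q permutes insert (n + 2) {1..Suc n}" by (rule permutes_comp_transpose[OF p]) simp
  moreover have "insert (n + 2) {1..Suc n} = {1..Suc (Suc n)}" by auto
  ultimately have q: "?q permutes {1..Suc (Suc n)}" by simp
  have "?q \<in> Av (Suc (Suc n)) \<longleftrightarrow>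
    p \<in> Av (Suc n) \<and> Suc n \<le> Suc (n + 1) \<and> (Suc n = Suc (n + 1) \<longrightarrow> ?q (Suc (Suc n)) < ?q (Suc n))"
    by (rule Av_insert_max_iff[OF p q]) (use fp in \<open>auto simp: transpose_def\<close>)
  then show ?thesis by simp
qed

text \<open>The new one-line notation ends in \<open>n + 3\<close>, \<open>n + 2\<close>,
  \<open>p (n + 1)\<close>. It arises by two insertions: \<open>n + 2\<close> before the last entry
  gives \<open>?r\<close>, then \<open>n + 3\<close> before the last two entries, which decrease
  automatically.\<close>

lemma Av_comp_transpose_2_iff:
  assumes p: "p permutes {1..Suc n}"
  shows "p \<circ> transpose (n + 1) (n + 3) \<in> Av (n + 3) \<longleftrightarrow> p \<in> Av (n + 1)"
proof -
  let ?r = "p \<circ> transpose (n + 1) (n + 2)"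
  let ?q = "p \<circ> transpose (n + 1) (n + 3)"
  have fp: "p (n + 2) = n + 2" "p (n + 3) = n + 3" by (rule permutes_not_in[OF p]; simp)+
  have "?r permutes insert (n + 2) {1..Suc n}" by (rule permutes_comp_transpose[OF p]) simp
  moreover have "insert (n + 2) {1..Suc n} = {1..n + 2}" by auto
  ultimately have r: "?r permutes {1..n + 2}" by simp
  have "?q permutes insert (n + 3) {1..n + 2}"
    by (rule permutes_comp_transpose[OF permutes_subset[OF p]]) auto
  moreover have "insert (n + 3) {1..n + 2} = {1..Suc (n + 2)}" by auto
  ultimately have q: "?q permutes {1..Suc (n + 2)}" by simp
  have "?q \<in> Av (Suc (n + 2)) \<longleftrightarrow>
    ?r \<in> Av (n + 2) \<and> n + 2 \<le> Suc (n + 1) \<and> (n + 2 = Suc (n + 1) \<longrightarrow> ?q (Suc (n + 2)) < ?q (n + 2))"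
    by (rule Av_insert_max_iff[OF r q]) (use fp in \<open>auto simp: transpose_def le_Suc_eq\<close>)
  moreover have "?q (Suc (n + 2)) < ?q (n + 2)"
    using permutes_le[OF p, of "n + 1"] fp by (simp add: transpose_def)
  ultimately show ?thesis using Av_comp_transpose_1_iff[OF p] by (simp add: numeral_3_eq_3)
qed

text \<open>The new one-line notation ends in \<open>n + 2\<close>, \<open>n + 3\<close>,
  \<open>p n\<close>, \<open>p (n + 1)\<close>. Inserting \<open>n + 2\<close> before the last two
  entries gives \<open>?r\<close>, and inserting \<open>n + 3\<close> right after it gives
  \<open>?q\<close>. Both insertions demand a descent in the same last two entries.\<close>

lemma Av_comp_transpose_3_iff:
  assumes p: "p permutes {1..Suc n}" and n: "n \<ge> 1"
  shows "p \<circ> transpose n (n + 2) \<circ> transpose (n + 1) (n + 3) \<in> Av (n + 3) \<longleftrightarrow>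
    p \<in> Av (n + 1) \<and> p (n + 1) < p n"
proof -
  let ?r = "p \<circ> transpose (n + 1) (n + 2) \<circ> transpose n (n + 1)"
  let ?q = "p \<circ> transpose n (n + 2) \<circ> transpose (n + 1) (n + 3)"
  have fp: "p (n + 2) = n + 2" "p (n + 3) = n + 3" by (rule permutes_not_in[OF p]; simp)+
  have "?r permutes insert (n + 1) (insert (n + 2) {1..Suc n})"
    using n by (intro permutes_comp_transpose p) auto
  moreover have "insert (n + 1) (insert (n + 2) {1..Suc n}) = {1..Suc (n + 1)}" by auto
  ultimately have r: "?r permutes {1..Suc (n + 1)}" by simp
  have "?q permutes insert (n + 3) (insert (n + 2) {1..Suc n})"
    using n by (intro permutes_comp_transpose p) auto
  moreover have "insert (n + 3) (insert (n + 2) {1..Suc n}) = {1..Suc (n + 2)}" by auto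
  ultimately have q: "?q permutes {1..Suc (n + 2)}" by simp
  have "?r \<in> Av (Suc (n + 1)) \<longleftrightarrow>
    p \<in> Av (n + 1) \<and> n + 1 \<le> Suc n \<and> (n + 1 = Suc n \<longrightarrow> ?r (Suc (n + 1)) < ?r (n + 1))"
    by (rule Av_insert_max_iff[OF _ r]) (use fp n p in \<open>auto simp: transpose_def le_Suc_eq\<close>)
  moreover have "?r (Suc (n + 1)) = p (n + 1)" "?r (n + 1) = p n"
    by (auto simp: transpose_def)
  ultimately have "?r \<in> Av (n + 2) \<longleftrightarrow> p \<in> Av (n + 1) \<and> p (n + 1) < p n"
    by simp
  moreover have "?q \<in> Av (Suc (n + 2)) \<longleftrightarrow>
    ?r \<in> Av (n + 2) \<and> n + 2 \<le> Suc (n + 1) \<and> (n + 2 = Suc (n + 1) \<longrightarrow> ?q (Suc (n + 2)) < ?q (n + 2))"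
    by (rule Av_insert_max_iff[OF _ q]) (use fp n r in \<open>auto simp: transpose_def le_Suc_eq\<close>)
  moreover have "?q (Suc (n + 2)) = p (n + 1)" "?q (n + 2) = p n"
    by (auto simp: transpose_def)
  ultimately show ?thesis by (auto simp: numeral_3_eq_3)
qed

section \<open>Decomposition by the position of the maximum\<close>

lemma permutes_obtain_preimage:
  assumes "p permutes S" "y \<in> S"
  obtains x where "x \<in> S" "p x = y"
  using permutes_image[OF assms(1)] assms(2) by (metis imageE)

text \<open>The maximum stands before the last position. If it is next to last, the descent is
  immediate; if it is further left, an ascent at the end would complete 312.\<close>

lemma Av_last_descent:
  assumes p: "p \<in> Av (Suc n)" and "p (Suc n) \<noteq> Suc n"
  shows "n \<ge> 1 \<and> p (Suc n) < p n"
proof -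
  have perm: "p permutes {1..Suc n}" using p by (rule Av_permutes)
  then obtain i where i: "i \<in> {1..Suc n}" "p i = Suc n"
    by (rule permutes_obtain_preimage[of p _ "Suc n"]) auto
  then have "i \<le> n" using assms(2) by (auto simp: le_Suc_eq)
  have le: "p (Suc n) \<le> n" using permutes_le[OF perm, of "Suc n"] assms(2) by simp
  have "p (Suc n) \<noteq> p n" using permutes_inj[OF perm] by (auto dest: injD)
  moreover have "\<not> p n < p (Suc n)"
  proof (cases "i = n")
    case True
    then show ?thesis using i le by simp
  next
    case False
    then show ?thesis using Av_no_312[OF p, of i n "Suc n"] i \<open>i \<le> n\<close> le by auto
  qed
  ultimately show ?thesis using i \<open>i \<le> n\<close> by simp
qed

lemma Av_decomposition:
  "Av (n + 3) = Av (n + 2) \<union> (\<lambda>p. p \<circ> transpose (n + 2) (n + 3)) ` Av (n + 2)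
    \<union> (\<lambda>p. p \<circ> transpose (n + 1) (n + 3)) ` Av (n + 1)
    \<union> (\<lambda>p. p \<circ> transpose n (n + 2) \<circ> transpose (n + 1) (n + 3)) ` (Av (n + 1) - Av n)"
    (is "_ = ?A \<union> ?B \<union> ?C \<union> ?D")
proof (intro equalityI subsetI)
  fix q assume "q \<in> ?A \<union> ?B \<union> ?C \<union> ?D"
  then consider "q \<in> ?A" | "q \<in> ?B" | "q \<in> ?C" | "q \<in> ?D" by blast
  then show "q \<in> Av (n + 3)"
  proof cases
    case 1
    then show ?thesis using Av_subset[of "n + 2"] by (auto simp: numeral_3_eq_3)
  next
    case 2
    then show ?thesis
      using Av_comp_transpose_1_iff[of _ "n + 1"] Av_permutes by (fastforce simp: numeral_3_eq_3)
  next
    case 3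
    then show ?thesis using Av_comp_transpose_2_iff[of _ n] Av_permutes by fastforce
  next
    case 4
    then obtain p where p: "p \<in> Av (Suc n) - Av n"
      and q: "q = p \<circ> transpose n (n + 2) \<circ> transpose (n + 1) (n + 3)" by auto
    \<comment> \<open>This also excludes \<open>n = 0\<close>, where the transposition would move
      position 0.\<close>
    have "n \<ge> 1 \<and> p (Suc n) < p n" using p Av_last_descent unfolding Av_diff by blast
    then show ?thesis using Av_comp_transpose_3_iff[of p n] p q Av_permutes[of p "Suc n"] by auto
  qed
next
  fix q assume Q: "q \<in> Av (n + 3)"
  have perm: "q permutes {1..n + 3}" using Q by (rule Av_permutes)
  have inj: "q i = q j \<longleftrightarrow> i = j" for i j using permutes_inj[OF perm] by (auto dest: injD)
  obtain i where i: "i \<in> {1..n + 3}" "q i = n + 3"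
    by (rule permutes_obtain_preimage[OF perm, of "n + 3"]) auto
  have less: "q j < n + 3" if "j \<noteq> i" "j \<le> n + 3" for j
    using permutes_le[OF perm that(2)] inj[of j i] i that(1) by auto
  have decr: "q k < q j" if "i < j" "j < k" "k \<le> n + 3" for j k
  proof -
    have "\<not> q j < q k" using Av_no_312[OF Q _ that] i less[of k] that by auto
    then show ?thesis using inj[of j k] that by simp
  qed
  have "n < i"
  proof (rule ccontr)
    assume "\<not> n < i"
    then show False
      using Av_no_4321[OF Q, of i "i + 1" "i + 2" "i + 3"] decr[of "i + 1" "i + 2"]
        decr[of "i + 2" "i + 3"] less[of "i + 1"] i by simp
  qed
  then consider "i = n + 3" | "i = n + 2" | "i = n + 1" using i by fastforce
  then show "q \<in> ?A \<union> ?B \<union> ?C \<union> ?D"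
  proof cases
    case 1
    then have "q \<in> ?A" using Q i Av_diff[of "n + 2"] by (auto simp: numeral_3_eq_3)
    then show ?thesis by blast
  next
    case 2
    let ?p = "q \<circ> transpose (n + 2) (n + 3)"
    have q: "q = ?p \<circ> transpose (n + 2) (n + 3)" by (simp add: comp_assoc)
    have "?p permutes insert (n + 3) {1..n + 3}" by (rule permutes_comp_transpose[OF perm]) simp
    then have "?p permutes {1..n + 2}"
      by (rule permutes_superset) (use i 2 in \<open>auto simp: le_Suc_eq numeral_3_eq_3\<close>)
    then have "?p \<in> Av (n + 2)"
      using Av_comp_transpose_1_iff[of ?p "n + 1"] Q q by (simp add: numeral_3_eq_3)
    then show ?thesis using q by blast
  next
    case 3
    have desc: "q (n + 3) < q (n + 2)" using decr[of "n + 2" "n + 3"] 3 by simp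
    show ?thesis
    proof (cases "q (n + 2) = n + 2")
      case True
      let ?p = "q \<circ> transpose (n + 1) (n + 3)"
      have q: "q = ?p \<circ> transpose (n + 1) (n + 3)" by (simp add: comp_assoc)
      have "?p permutes insert (n + 3) {1..n + 3}" by (rule permutes_comp_transpose[OF perm]) simp
      then have "?p permutes {1..Suc n}"
        by (rule permutes_superset)
          (use i 3 True in \<open>auto simp: le_Suc_eq numeral_3_eq_3 transpose_def\<close>)
      then have "?p \<in> Av (n + 1)"
        using Av_comp_transpose_2_iff[of ?p n] Q q by simp
      then show ?thesis using q by blast
    next
      case False
      \<comment> \<open>The second largest entry \<open>n + 2\<close>, if it came after the maximum,
        would head the decreasing pair at position \<open>n + 2\<close>, which is excluded. So it
        precedes the maximum.\<close>
      obtain j where j: "j \<in> {1..n + 3}" "q j = n + 2"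
        by (rule permutes_obtain_preimage[OF perm, of "n + 2"]) auto
      have less2: "q k < n + 2" if "k \<noteq> i" "k \<noteq> j" "k \<le> n + 3" for k
        using less[of k] inj[of k j] j that by auto
      have "j \<noteq> n + 1" "j \<noteq> n + 2" using i 3 j False by auto
      \<comment> \<open>If \<open>j < n\<close>, compare the entries at \<open>n\<close> and
        \<open>n + 2\<close>: an ascent gives 312 with the entry at \<open>j\<close> as the 3, and a
        descent gives 4321 at positions \<open>j\<close>, \<open>n\<close>, \<open>n + 2\<close>,
        \<open>n + 3\<close>.\<close>
      moreover have "j \<noteq> n + 3" using desc less[of "n + 2"] 3 j by auto
      ultimately have "j \<le> n" using j by auto
      moreover have "\<not> j < n"
      proof
        assume "j < n"
        then have "\<not> q n < q (n + 2)"
          using Av_no_312[OF Q, of j n "n + 2"] less2[of "n + 2"] j 3 by auto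
        then have "q (n + 2) < q n" using inj[of n "n + 2"] by simp
        then show False
          using Av_no_4321[OF Q, of j n "n + 2" "n + 3"] desc less2[of n] \<open>j < n\<close> j 3 by auto
      qed
      ultimately have jn: "j = n" by simp
      let ?p = "q \<circ> transpose (n + 1) (n + 3) \<circ> transpose n (n + 2)"
      have n: "n \<ge> 1" using j jn by simp
      have q: "q = ?p \<circ> transpose n (n + 2) \<circ> transpose (n + 1) (n + 3)" by (simp add: comp_assoc)
      have "?p permutes insert (n + 2) (insert (n + 3) {1..n + 3})"
        using n by (intro permutes_comp_transpose perm) auto
      then have p: "?p permutes {1..Suc n}"
        by (rule permutes_superset)
          (use i 3 j jn in \<open>auto simp: le_Suc_eq numeral_3_eq_3 transpose_def\<close>)
      have "?p \<in> Av (n + 1) \<and> ?p (n + 1) < ?p n"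
        using Av_comp_transpose_3_iff[OF p n] Q q by simp
      \<comment> \<open>Together with the final descent this bounds \<open>?p (n + 1)\<close>
        strictly below \<open>n + 1\<close>, so that point is not fixed and \<open>?p\<close> is
        outside \<open>Av n\<close>.\<close>
      moreover have "?p n \<le> Suc n" using permutes_le[OF p, of n] by simp
      ultimately have "?p \<in> Av (n + 1) - Av n" using Av_diff[of n] by simp
      then show ?thesis using q by blast
    qed
  qed
qed

section \<open>Cycle polynomials and their recurrence\<close>

text \<open>Summing over permutations instead of cycle numbers lets a disjoint decomposition of
  \<open>Av n\<close> turn directly into a recurrence.\<close>

definition cyc_poly :: "nat \<Rightarrow> int poly" where
  "cyc_poly n = (\<Sum>p\<in>Av n. monom 1 (cyc n p))"

lemma cyc_pos: "n \<ge> 1 \<Longrightarrow> cyc n p \<ge> 1"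
  by (simp add: cyc_def Suc_le_eq card_gt_0_iff)

lemma cyc_gf_nth: "fps_nth cyc_gf n = (if n = 0 then 0 else cyc_poly n)"
proof (rule poly_eqI)
  fix k
  have "coeff (cyc_poly n) k = int (cyc_count n k)"
    using finite_Av[of n]
    by (simp add: cyc_poly_def coeff_sum cyc_count_def Av_def sum.If_cases Int_def conj_commute)
  moreover have "cyc_count n 0 = 0" if "n \<noteq> 0"
  proof -
    have "cyc n p = 0 \<longleftrightarrow> False" for p using cyc_pos[of n p] that by simp
    then show ?thesis by (simp only: cyc_count_def) simp
  qed
  ultimately show "coeff (fps_nth cyc_gf n) k = coeff (if n = 0 then 0 else cyc_poly n) k"
    unfolding coeff_cyc_gf by (cases "k = 0") auto
qed

lemma monom_1_Suc: "monom (1::int) (Suc n) = [:0, 1:] * monom 1 n"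
  by (simp add: monom_Suc)

lemma inj_comp_transpose: "inj (\<lambda>p. p \<circ> transpose a b)"
  by (rule injI) (metis comp_assoc comp_id transpose_comp_involutory)

text \<open>With a(n) for \<open>cyc_poly n\<close>, the four parts of
  \<open>Av_decomposition\<close> contribute t a(n+2), a(n+2), t a(n+1) and a(n+1) - t a(n).\<close>

lemma cyc_poly_rec:
  "cyc_poly (n + 3) =
    (1 + [:0, 1:]) * (cyc_poly (n + 2) + cyc_poly (n + 1)) - [:0, 1:] * cyc_poly n"
proof -
  let ?t = "[:0, 1:] :: int poly"
  let ?f = "\<lambda>p. monom (1::int) (cyc (n + 3) p)"
  let ?b = "\<lambda>p. p \<circ> transpose (n + 2) (n + 3)"
  let ?c = "\<lambda>p. p \<circ> transpose (n + 1) (n + 3)"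
  let ?d = "\<lambda>p. p \<circ> transpose n (n + 2) \<circ> transpose (n + 1) (n + 3)"
  let ?D = "Av (n + 1) - Av n"
  have fp: "p k = k" if "p \<in> Av m" "m < k" for p m k
    by (rule permutes_not_in[OF Av_permutes[OF that(1)]]) (use that(2) in simp)
  \<comment> \<open>The position of \<open>n + 3\<close> separates the parts, except the last two,
    which differ in the position of \<open>n + 2\<close>.\<close>
  have pA: "p (n + 3) = n + 3" if "p \<in> Av (n + 2)" for p
    using fp[OF that] by simp
  have pB: "?b p (n + 2) = n + 3" if "p \<in> Av (n + 2)" for p
    using fp[OF that] by simp
  have pC: "?c p (n + 1) = n + 3 \<and> ?c p (n + 2) = n + 2" if "p \<in> Av (n + 1)" for p
    using fp[OF that] by (simp add: transpose_def)
  have pD: "?d p (n + 1) = n + 3 \<and> ?d p n = n + 2" if "p \<in> ?D" for p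
    using fp[of p "n + 1"] that by (simp add: transpose_def)
  have inj: "x = y" if "q \<in> Av (n + 3)" "q x = q y" for q x y
    using permutes_inj[OF Av_permutes[OF that(1)]] that(2) by (auto dest: injD)
  have mem: "Av (n + 2) \<subseteq> Av (n + 3)" "?b ` Av (n + 2) \<subseteq> Av (n + 3)"
    "?c ` Av (n + 1) \<subseteq> Av (n + 3)" "?d ` ?D \<subseteq> Av (n + 3)"
    unfolding Av_decomposition[of n] by blast+
  have disj: "Av (n + 2) \<inter> ?b ` Av (n + 2) = {}"
    "(Av (n + 2) \<union> ?b ` Av (n + 2)) \<inter> ?c ` Av (n + 1) = {}"
    "(Av (n + 2) \<union> ?b ` Av (n + 2) \<union> ?c ` Av (n + 1)) \<inter> ?d ` ?D = {}"
  proof -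
    have A: "q (n + 3) = n + 3" if "q \<in> Av (n + 2)" for q using pA that .
    have B: "q (n + 2) = n + 3" if "q \<in> ?b ` Av (n + 2)" for q using pB that by blast
    have C: "q (n + 1) = n + 3 \<and> q (n + 2) = n + 2" if "q \<in> ?c ` Av (n + 1)" for q
      using pC that by blast
    have D: "q (n + 1) = n + 3 \<and> q n = n + 2" if "q \<in> ?d ` ?D" for q using pD that by blast
    have "False" if "q \<in> Av (n + 2)" "q \<in> ?b ` Av (n + 2)" for q
    proof -
      have "q (n + 3) = q (n + 2)" using A[OF that(1)] B[OF that(2)] by simp
      then show False using inj[of q "n + 3" "n + 2"] mem that by auto
    qed
    then show "Av (n + 2) \<inter> ?b ` Av (n + 2) = {}" by blast
    have "False" if "q \<in> Av (n + 2) \<union> ?b ` Av (n + 2)" "q \<in> ?c ` Av (n + 1) \<or> q \<in> ?d ` ?D" for q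
    proof -
      have "q (n + 1) = n + 3" "q \<in> Av (n + 3)" using that(2) C D mem by auto
      moreover have "q (n + 2) = n + 3 \<or> q (n + 3) = n + 3" using that(1) A B by blast
      ultimately show False using inj[of q "n + 1" "n + 2"] inj[of q "n + 1" "n + 3"] by auto
    qed
    moreover have "False" if "q \<in> ?c ` Av (n + 1)" "q \<in> ?d ` ?D" for q
      using C[OF that(1)] D[OF that(2)] that mem inj[of q n "n + 2"] by auto
    ultimately show "(Av (n + 2) \<union> ?b ` Av (n + 2)) \<inter> ?c ` Av (n + 1) = {}"
      "(Av (n + 2) \<union> ?b ` Av (n + 2) \<union> ?c ` Av (n + 1)) \<inter> ?d ` ?D = {}" by blast+
  qed
  have inj_d: "inj ?d"
    using inj_compose[OF inj_comp_transpose[of "n + 1" "n + 3"] inj_comp_transpose[of n "n + 2"]]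
    by (simp add: o_def)
  have perm: "p permutes {1..Suc n}" if "p \<in> Av (n + 1)" for p
    using Av_permutes[OF that] by simp
  have "cyc_poly (n + 3) = sum ?f (Av (n + 2)) + sum ?f (?b ` Av (n + 2))
      + sum ?f (?c ` Av (n + 1)) + sum ?f (?d ` ?D)"
    unfolding cyc_poly_def Av_decomposition[of n]
    using disj finite_Av by (simp add: sum.union_disjoint del: Un_iff)
  moreover have "sum ?f (Av (n + 2)) = ?t * cyc_poly (n + 2)"
    unfolding cyc_poly_def sum_distrib_left
    by (rule sum.cong[OF refl])
      (use cyc_Suc_fixpoint[OF Av_permutes] in \<open>simp add: monom_1_Suc numeral_3_eq_3\<close>)
  moreover have "sum ?f (?b ` Av (n + 2)) = cyc_poly (n + 2)"
    unfolding cyc_poly_def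
    by (subst sum.reindex[OF inj_on_subset[OF inj_comp_transpose]], simp, rule sum.cong[OF refl])
      (use cyc_comp_transpose_1[of _ "n + 1"] Av_permutes[of _ "n + 2"] in \<open>simp add: numeral_3_eq_3\<close>)
  moreover have "sum ?f (?c ` Av (n + 1)) = ?t * cyc_poly (n + 1)"
    unfolding cyc_poly_def sum_distrib_left
    by (subst sum.reindex[OF inj_on_subset[OF inj_comp_transpose]], simp, rule sum.cong[OF refl])
      (use cyc_comp_transpose_2 perm in \<open>simp add: monom_1_Suc\<close>)
  moreover have "sum ?f (?d ` ?D) = cyc_poly (n + 1) - ?t * cyc_poly n"
  proof -
    have "sum ?f (?d ` ?D) = (\<Sum>p\<in>?D. monom 1 (cyc (n + 1) p))"
    proof (subst sum.reindex[OF inj_on_subset[OF inj_d]], simp, rule sum.cong[OF refl])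
      fix p assume p: "p \<in> ?D"
      then have "n \<ge> 1" using Av_last_descent[of p n] Av_diff[of n] by auto
      then show "(?f \<circ> ?d) p = monom 1 (cyc (n + 1) p)"
        using cyc_comp_transpose_3 perm p by simp
    qed
    \<comment> \<open>The subtracted permutations fix \<open>n + 1\<close>, which is one cycle more
      than on \<open>{1..n}\<close>; this is the source of the factor t.\<close>
    also have "\<dots> = cyc_poly (n + 1) - (\<Sum>p\<in>Av n. monom 1 (cyc (n + 1) p))"
      unfolding cyc_poly_def by (rule sum_diff) (use finite_Av Av_subset in auto)
    also have "(\<Sum>p\<in>Av n. monom 1 (cyc (n + 1) p)) = ?t * cyc_poly n"
      unfolding cyc_poly_def sum_distrib_left
      by (rule sum.cong[OF refl])
        (use cyc_Suc_fixpoint[OF Av_permutes] in \<open>simp add: monom_1_Suc\<close>)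
    finally show ?thesis .
  qed
  ultimately show ?thesis by (simp only: algebra_simps)
qed

section \<open>Initial values and the generating function\<close>

text \<open>There are too few positions for a pattern of length 3 or 4.\<close>

lemma Av_small: "n \<le> 2 \<Longrightarrow> Av n = {p. p permutes {1..n}}"
  unfolding Av_iff set_eq_iff by auto

lemma cyc_0: "cyc 0 p = 0"
  by (simp add: cyc_def)

lemma cyc_poly_0: "cyc_poly 0 = 1"
  by (simp add: cyc_poly_def Av_small cyc_0)

lemma cyc_poly_1: "cyc_poly 1 = [:0, 1:]"
proof -
  have "cyc 1 id = 1" using cyc_Suc_fixpoint[of id 0] by (simp add: cyc_0)
  then show ?thesis by (simp add: cyc_poly_def Av_small monom_Suc)
qed

lemma cyc_poly_2: "cyc_poly 2 = (1 + [:0, 1:]) * [:0, 1:]"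
proof -
  have 1: "cyc 1 id = 1" using cyc_Suc_fixpoint[of id 0] by (simp add: cyc_0)
  then have 2: "cyc 2 id = 2" using cyc_Suc_fixpoint[of id 1] by (simp add: numeral_2_eq_2)
  have 3: "cyc 2 (transpose 1 2) = 1"
    using cyc_comp_transpose_1[of id 0] 1 by (simp add: numeral_2_eq_2)
  have "{1..2::nat} = {1, 2}" by auto
  then have "Av 2 = {id, transpose 1 2}"
    using permutes_doubleton_iff[of _ 1 "2::nat"] by (auto simp: Av_small)
  moreover have "id \<noteq> transpose 1 (2::nat)"
    by (metis id_apply numeral_eq_one_iff semiring_norm(85) transpose_apply_first)
  ultimately have "cyc_poly 2 = monom 1 2 + monom 1 1"
    using 2 3 by (simp add: cyc_poly_def)
  also have "\<dots> = (1 + [:0, 1:]) * [:0, 1:]"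
    by (simp add: numeral_2_eq_2 monom_Suc one_pCons)
  finally show ?thesis .
qed

theorem theorem1:
  shows "let t = fps_const [:0, 1:]; z = fps_X :: int poly fps in
    cyc_gf = t * z * (1 - z ^ 2) * fps_right_inverse (1 - (1 + t) * (z + z ^ 2) + t * z ^ 3) 1"
proof -
  define c where "c = ([:0, 1:] :: int poly)"
  define t where "t = fps_const c"
  define z where "z = (fps_X :: int poly fps)"
  let ?D = "1 - (1 + t) * (z + z ^ 2) + t * z ^ 3"
  \<comment> \<open>By \<open>fps_quotient_iff\<close> it suffices to clear the denominator and
    compare coefficients.\<close>
  have "cyc_gf * ?D = t * z * (1 - z ^ 2)"
  proof (rule fps_ext)
    fix n
    \<comment> \<open>Every shift, even by one, is written as a power of \<open>z\<close> so that
      one rule for coefficients covers all terms.\<close>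
    have "cyc_gf * ?D = cyc_gf - fps_const (1 + c) * (z ^ 1 * cyc_gf) -
        fps_const (1 + c) * (z ^ 2 * cyc_gf) + fps_const c * (z ^ 3 * cyc_gf)"
      unfolding t_def fps_const_add[symmetric] by (simp add: algebra_simps)
    then have L: "fps_nth (cyc_gf * ?D) n = fps_nth cyc_gf n
        - (1 + c) * (if n < 1 then 0 else fps_nth cyc_gf (n - 1))
        - (1 + c) * (if n < 2 then 0 else fps_nth cyc_gf (n - 2))
        + c * (if n < 3 then 0 else fps_nth cyc_gf (n - 3))"
      by (simp only: z_def fps_add_nth fps_sub_nth fps_mult_left_const_nth fps_X_power_mult_nth)
    have "t * z * (1 - z ^ 2) = fps_const c * z ^ 1 - fps_const c * z ^ 3"
      by (simp add: t_def algebra_simps power2_eq_square power3_eq_cube)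
    then have R: "fps_nth (t * z * (1 - z ^ 2)) n =
        c * (if n = 1 then 1 else 0) - c * (if n = 3 then 1 else 0)"
      by (simp only: z_def fps_sub_nth fps_mult_left_const_nth fps_X_power_nth)
    consider "n = 0" | "n = 1" | "n = 2" | "n = 3" | m where "n = Suc m + 3"
      by (metis One_nat_def Suc_1 add.commute add_Suc_right not0_implies_Suc numeral_3_eq_3 plus_nat.add_0)
    then show "fps_nth (cyc_gf * ?D) n = fps_nth (t * z * (1 - z ^ 2)) n"
    proof cases
      case 1
      then show ?thesis unfolding L R cyc_gf_nth by simp
    next
      case 2
      then show ?thesis unfolding L R cyc_gf_nth using cyc_poly_1 by (simp add: c_def)
    next
      case 3
      then show ?thesis unfolding L R cyc_gf_nth using cyc_poly_1 cyc_poly_2 by (simp add: c_def)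
    next
      \<comment> \<open>The recurrence involves \<open>cyc_poly 0 = 1\<close>, but the series has
        constant term 0. The difference is the term -t z^3 of the numerator.\<close>
      case 4
      then show ?thesis
        unfolding L R cyc_gf_nth using cyc_poly_rec[of 0] cyc_poly_0
        by (simp add: c_def[symmetric] eval_nat_numeral algebra_simps del: mult_pCons_left mult_pCons_right)
    next
      case (5 m)
      then show ?thesis
        unfolding L R cyc_gf_nth using cyc_poly_rec[of "Suc m"]
        by (simp add: c_def[symmetric] eval_nat_numeral algebra_simps del: mult_pCons_left mult_pCons_right)
    qed
  qed
  then have "cyc_gf = t * z * (1 - z ^ 2) * fps_right_inverse ?D 1"
    by (subst fps_quotient_iff) (simp_all add: t_def z_def)
  then show ?thesis by (simp add: t_def z_def c_def Let_def)
qed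

end
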